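(* Suppose $n \in \mathbb{N}$ is not a product of two primes and $n=p_1^{\alpha_1}p_2^{\alpha_2}\cdots p_r^{\alpha_r}$, where $r \geq 2$, $p_1 < p_2 < \cdots < p_r$ are primes and $\alpha_i \in \mathbb{N}$ for all $1 \leq i \leq r$. Then for any $1 \leq k \leq r$, the following statements hold: (i) $\widetilde{N}\left(\left[\overline{p_k^{\alpha_k}}\right]\right)$ is a minimal separating set of $\widetilde{\mathcal{G}}(\mathbb{Z}_n)$. (ii) If $\alpha_k > 1$ and $1 \leq \beta_k < \alpha_k$, then $\widetilde{N}\left(\left[\overline{p_k^{\beta_k}}\right]\right)$ is not a minimal separating set of $\widetilde{\mathcal{G}}(\mathbb{Z}_n)$.
   Context: $\mathbb{N}$ denotes the positive integers. $\mathbb{Z}_n$ is the additive group of integers modulo $n$, and $\overline{a}$ is the residue class of $a$. The power graph $\mathcal{G}(\mathbb{Z}_n)$ is the simple undirected graph with vertex set $\mathbb{Z}_n$ in which two distinct vertices are adjacent if one is a positive integer multiple of the other. Let $\mathcal{S}(\mathbb{Z}_n)=\{\overline{a} : 1\le a<n,\ \gcd(a,n)=1\}\cup\{\overline{0}\}$, and let $\widetilde{\mathcal{G}}(\mathbb{Z}_n)$ be the graph obtained from $\mathcal{G}(\mathbb{Z}_n)$ by deleting all vertices in $\mathcal{S}(\mathbb{Z}_n)$. For $x\in\mathbb{Z}_n$, $[x]=\{y\in\mathbb{Z}_n : \langle y\rangle=\langle x\rangle\}$, where $\langle x\rangle$ is the cyclic subgroup generated by $x$. For a set $A$ of vertices of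 $\mathcal{G}(\mathbb{Z}_n)$, $N(A)$ is the set of all vertices of $\mathcal{G}(\mathbb{Z}_n)$ not in $A$ that are adjacent to some element of $A$; and $\widetilde{N}([\overline{a}])=N([\overline{a}])\setminus\mathcal{S}(\mathbb{Z}_n)$. A separating set of a graph $\Gamma$ is a set of vertices whose removal increases the number of components of $\Gamma$; it is minimal if none of its non-empty proper subsets disconnects $\Gamma$ when removed. *)

theory Defs
  imports
    "HOL-Computational_Algebra.Primes"
    "HOL-Algebra.Elementary_Groups"
    "Graph_Theory.Graph_Theory"
begin

text \<open>
  Simple undirected graphs are rendered as loop-free symmetric digraphs without parallel arcs
  (the locale \<^term>\<open>graph\<close>). On these, strongly connected components are
  exactly the connected components.
\<close>

definition delete_verts :: "('a, 'b) pre_digraph \<Rightarrow> 'a set \<Rightarrow> ('a, 'b) pre_digraph" where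
  "delete_verts \<Gamma> X = induce_subgraph \<Gamma> (verts \<Gamma> - X)"

text \<open>Only meaningful for finite graphs, since \<^term>\<open>card\<close> is 0 on infinite sets.\<close>

definition num_components :: "('a, 'b) pre_digraph \<Rightarrow> nat" where
  "num_components \<Gamma> = card (pre_digraph.sccs \<Gamma>)"

definition separating_set :: "('a, 'b) pre_digraph \<Rightarrow> 'a set \<Rightarrow> bool" where
  "separating_set \<Gamma> X \<longleftrightarrow>
     X \<subseteq> verts \<Gamma> \<and> num_components (delete_verts \<Gamma> X) > num_components \<Gamma>"

text \<open>
  The library predicate \<^term>\<open>connected\<close> is false on the graph without vertices. This is harmless
  below: a proper subset of a set of vertices never exhausts the vertices.
\<close>

definition minimal_separating_set :: "('a, 'b) pre_digraph \<Rightarrow> 'a set \<Rightarrow> bool" where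
  "minimal_separating_set \<Gamma> X \<longleftrightarrow>
     separating_set \<Gamma> X \<and> (\<forall>Y. Y \<noteq> {} \<and> Y \<subset> X \<longrightarrow> connected (delete_verts \<Gamma> Y))"

definition neighbourhood :: "('a, 'b) pre_digraph \<Rightarrow> 'a set \<Rightarrow> 'a set" where
  "neighbourhood \<Gamma> A = {v \<in> verts \<Gamma> - A. \<exists>a\<in>A. a \<rightarrow>\<^bsub>\<Gamma>\<^esub> v}"

text \<open>
  Groups are written multiplicatively in the library, so that a positive integer multiple
  of \<open>x\<close> is a power with positive exponent.
\<close>

definition power_graph :: "('a, 'm) monoid_scheme \<Rightarrow> ('a, 'a \<times> 'a) pre_digraph" where
  "power_graph G = with_proj
     \<lparr> pverts = carrier G,
       parcs = {(x, y). x \<in> carrier G \<and> y \<in> carrier G \<and> x \<noteq> y \<and>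
                  (\<exists>m::nat. m > 0 \<and> (y = x [^]\<^bsub>G\<^esub> m \<or> x = y [^]\<^bsub>G\<^esub> m))} \<rparr>"

lemma graph_power_graph:
  assumes "finite (carrier G)"
  shows "graph (power_graph G)"
proof -
  have "finite {(x, y). x \<in> carrier G \<and> y \<in> carrier G \<and> x \<noteq> y \<and>
                  (\<exists>m::nat. m > 0 \<and> (y = x [^]\<^bsub>G\<^esub> m \<or> x = y [^]\<^bsub>G\<^esub> m))}"
    by (rule finite_subset[of _ "carrier G \<times> carrier G"]) (use assms in auto)
  then have "pair_graph \<lparr> pverts = carrier G,
       parcs = {(x, y). x \<in> carrier G \<and> y \<in> carrier G \<and> x \<noteq> y \<and>
                  (\<exists>m::nat. m > 0 \<and> (y = x [^]\<^bsub>G\<^esub> m \<or> x = y [^]\<^bsub>G\<^esub> m))} \<rparr>"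
    using assms by unfold_locales (auto simp: symmetric_def sym_def)
  then show ?thesis
    unfolding power_graph_def by (rule pair_graph.pair_graphD_graph)
qed

definition generator_class :: "('a, 'm) monoid_scheme \<Rightarrow> 'a \<Rightarrow> 'a set" where
  "generator_class G x = {y \<in> carrier G. generate G {y} = generate G {x}}"

text \<open>
  The library group \<^term>\<open>integer_mod_group n\<close> has carrier \<open>{0..<n}\<close> for \<open>n > 0\<close>;
  a residue class is identified with its representative there.
\<close>

definition residue :: "nat \<Rightarrow> nat \<Rightarrow> int" where
  "residue n a = int a mod int n"

definition S_set :: "nat \<Rightarrow> int set" where
  "S_set n = {residue n a | a. 1 \<le> a \<and> a < n \<and> gcd a n = 1} \<union> {residue n 0}"

definition reduced_power_graph :: "nat \<Rightarrow> (int, int \<times> int) pre_digraph" where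
  "reduced_power_graph n = delete_verts (power_graph (integer_mod_group n)) (S_set n)"

definition reduced_neighbourhood :: "nat \<Rightarrow> int set \<Rightarrow> int set" where
  "reduced_neighbourhood n A = neighbourhood (power_graph (integer_mod_group n)) A - S_set n"

end

theory Submission
  imports Defs
begin

text \<open>
  In \<open>\<int>\<^sub>n\<close> one element is a positive multiple of another exactly when the index of the cyclic
  subgroup generated by the latter divides the index for the former. Adjacency, generator classes and
  the removed set \<^const>\<open>S_set\<close> therefore only depend on the index \<open>gcd x n\<close> of a vertex \<open>x\<close>,
  and the reduced power graph is a blow-up of the comparability graph of the divisors \<open>d\<close> of \<open>n\<close> with
  \<open>1 < d < n\<close>, ordered by divisibility.

  Write \<open>n = p\<^sup>a * m\<close> with \<open>p\<close> prime, \<open>p\<close> not dividing \<open>m\<close> and \<open>m > 1\<close>, and let \<open>X\<close> be the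
  neighbourhood of the class of \<open>p\<^sup>a\<close>. Removing \<open>X\<close> isolates this class from every prime factor of
  \<open>m\<close>. On the other hand, the divisors that are incomparable with \<open>p\<^sup>a\<close> form a connected piece,
  because each of them has a prime factor \<open>q\<close> of \<open>m\<close>, and two such primes are joined through
  their product. Every vertex of \<open>X\<close> is adjacent both to the class of \<open>p\<^sup>a\<close> and to this piece,
  so one vertex of \<open>X\<close> left in place suffices to keep everything together
  (\<open>strongly_connected_of_proper_subset\<close>). Applied to the empty subset this says that the graph
  itself is connected; the subset is proper since \<open>X\<close> is not empty, and this is where
  \<open>n\<close> must not be a product of two primes.

  For \<open>b < a\<close> the neighbourhood of the class of \<open>p\<^sup>b\<close> contains the vertices of index
  \<open>p\<^sup>b\<^sup>+\<^sup>1, \<dots>, p\<^sup>a\<close>. Leaving them in place still separates the chain \<open>p\<^sup>b, \<dots>, p\<^sup>a\<close> from the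
  prime factors of \<open>m\<close>, for any further neighbour of the chain is comparable with \<open>p\<^sup>b\<close>
  (\<open>not_connected_without_chain_boundary\<close>). So a smaller set already disconnects. The case
  \<open>b = a\<close> of the same lemma shows that \<open>X\<close> separates.
\<close>

section \<open>Deleting vertices and counting components\<close>

lemma pseudo_graph_delete_verts:
  assumes "pseudo_graph \<Gamma>"
  shows "pseudo_graph (delete_verts \<Gamma> Y)"
proof -
  interpret pseudo_graph \<Gamma> by (fact assms)
  have ind: "induced_subgraph (delete_verts \<Gamma> Y) \<Gamma>"
    unfolding delete_verts_def by (rule induced_induce) auto
  interpret H: sym_digraph "delete_verts \<Gamma> Y"
    using ind by (rule induced_graph_imp_graph)
  show ?thesis
    by unfold_locales (auto simp: delete_verts_def)
qed

lemma delete_verts_empty: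
  assumes "wf_digraph \<Gamma>"
  shows "delete_verts \<Gamma> {} = \<Gamma>"
proof -
  interpret wf_digraph \<Gamma> by (fact assms)
  show ?thesis
    by (intro pre_digraph.equality) (auto simp: delete_verts_def)
qed

lemma dominates_delete_verts_iff:
  "u \<rightarrow>\<^bsub>delete_verts \<Gamma> Y\<^esub> v \<longleftrightarrow>
     u \<in> verts \<Gamma> - Y \<and> v \<in> verts \<Gamma> - Y \<and> u \<rightarrow>\<^bsub>\<Gamma>\<^esub> v"
  by (auto simp: delete_verts_def arcs_ends_conv)

lemma (in wf_digraph) num_components_strongly_connected:
  assumes "strongly_connected G"
  shows "num_components G = 1"
  using assms by (simp add: num_components_def strongly_connected_eq_iff)

lemma (in fin_digraph) num_components_gt_1:
  assumes "u \<in> verts G" "w \<in> verts G" "\<not> u \<rightarrow>\<^sup>*\<^bsub>G\<^esub> w"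
  shows "num_components G > 1"
proof -
  have "scc_of u \<noteq> scc_of w"
    using assms in_scc_of_self[of w] by (auto simp: scc_of_def)
  moreover have "{scc_of u, scc_of w} \<subseteq> sccs_verts"
    using assms by (simp add: scc_of_in_sccs_verts)
  then have "card {scc_of u, scc_of w} \<le> card sccs_verts"
    using finite_sccs_verts by (intro card_mono)
  ultimately show ?thesis
    by (simp add: num_components_def card_sccs_verts)
qed

lemma (in sym_digraph) strongly_connected_if_all_reach:
  assumes "x \<in> verts G" "\<And>v. v \<in> verts G \<Longrightarrow> v \<rightarrow>\<^sup>* x"
  shows "strongly_connected G"
  using assms by (intro strongly_connectedI) (auto intro: reachable_trans symmetric_reachable')

section \<open>Indices of cyclic subgroups\<close>

text \<open>The index of the subgroup of the integers modulo \<open>n\<close> generated by \<open>x\<close>.\<close>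

definition cyc_index :: "nat \<Rightarrow> int \<Rightarrow> nat" where
  "cyc_index n x = nat (gcd x (int n))"

abbreviation comparable :: "nat \<Rightarrow> nat \<Rightarrow> bool" where
  "comparable d e \<equiv> d dvd e \<or> e dvd d"

lemma int_cyc_index: "int (cyc_index n x) = gcd x (int n)"
  by (simp add: cyc_index_def)

lemma cyc_index_dvd: "cyc_index n x dvd n"
  by (metis gcd_dvd2 int_cyc_index int_dvd_int_iff)

lemma cyc_index_of_nat: "cyc_index n (int k) = gcd k n"
  by (simp add: cyc_index_def)

lemma cyc_index_of_divisor: "d dvd n \<Longrightarrow> cyc_index n (int d) = d"
  by (simp add: cyc_index_of_nat gcd_nat.absorb1)

lemma cyc_index_dvd_cyc_index_iff:
  "cyc_index n x dvd cyc_index n y \<longleftrightarrow> gcd x (int n) dvd y"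
  unfolding int_dvd_int_iff[symmetric] int_cyc_index by simp

lemma multiple_mod_iff_cyc_index_dvd:
  assumes "n > 0" "y \<in> {0..<int n}"
  shows "(\<exists>k. y = (k * x) mod int n) \<longleftrightarrow> cyc_index n x dvd cyc_index n y"
  unfolding cyc_index_dvd_cyc_index_iff
proof
  assume "\<exists>k. y = (k * x) mod int n"
  then show "gcd x (int n) dvd y"
    by (auto simp: dvd_mod)
next
  assume "gcd x (int n) dvd y"
  then obtain t where t: "y = gcd x (int n) * t" ..
  obtain u v where "u * x + v * int n = gcd x (int n)"
    using bezout_int by blast
  with t have "y = (u * x + v * int n) * t"
    by simp
  then have "y = (t * u) * x + (t * v) * int n"
    by (simp add: algebra_simps)
  then have "((t * u) * x) mod int n = y mod int n"
    by simp
  then show "\<exists>k. y = (k * x) mod int n"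
    using assms(2) by (intro exI[of _ "t * u"]) simp
qed

lemma positive_multiple_iff_cyc_index_dvd:
  assumes "n > 0" "y \<in> {0..<int n}"
  shows "(\<exists>k::nat. k > 0 \<and> y = (int k * x) mod int n) \<longleftrightarrow> cyc_index n x dvd cyc_index n y"
proof -
  have "\<exists>k::nat. k > 0 \<and> y = (int k * x) mod int n" if "y = (k * x) mod int n" for k
  proof (intro exI conjI)
    \<comment> \<open>Adding \<open>n\<close> makes the residue of the factor positive.\<close>
    let ?k = "nat (k mod int n + int n)"
    have nonneg: "0 \<le> k mod int n"
      using assms(1) by simp
    then show "?k > 0"
      using assms(1) by (simp add: add_nonneg_pos)
    have "int ?k mod int n = k mod int n"
      using nonneg by simp
    then have "(int ?k * x) mod int n = (k * x) mod int n"
      by (metis mod_mult_left_eq)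
    with that show "y = (int ?k * x) mod int n"
      by simp
  qed
  then show ?thesis
    unfolding multiple_mod_iff_cyc_index_dvd[OF assms, symmetric] by blast
qed

lemma generator_class_integer_mod_group:
  assumes "n > 0" "x \<in> {0..<int n}"
  shows "generator_class (integer_mod_group n) x =
           {y \<in> {0..<int n}. cyc_index n y = cyc_index n x}"
proof -
  have gen: "generate (integer_mod_group n) {z} =
               {y \<in> {0..<int n}. cyc_index n z dvd cyc_index n y}"
    if "z \<in> {0..<int n}" for z
  proof -
    have "generate (integer_mod_group n) {z} = {(k * z) mod int n | k. True}"
      using that assms(1)
      by (simp add: group.generate_pow carrier_integer_mod_group int_pow_integer_mod_group)
    also have "\<dots> = {y \<in> {0..<int n}. \<exists>k. y = (k * z) mod int n}"
      using assms(1) by auto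
    finally show ?thesis
      using multiple_mod_iff_cyc_index_dvd[OF assms(1)] by auto
  qed
  have "generate (integer_mod_group n) {y} = generate (integer_mod_group n) {x} \<longleftrightarrow>
          cyc_index n y = cyc_index n x" if "y \<in> {0..<int n}" for y
  proof
    assume eq: "generate (integer_mod_group n) {y} = generate (integer_mod_group n) {x}"
    have "y \<in> generate (integer_mod_group n) {y}" "x \<in> generate (integer_mod_group n) {x}"
      using that assms(2) by (simp_all add: gen)
    then have "y \<in> generate (integer_mod_group n) {x}" "x \<in> generate (integer_mod_group n) {y}"
      by (simp_all only: eq)
    then show "cyc_index n y = cyc_index n x"
      using that assms(2) by (simp add: gen dvd_antisym)
  qed (simp only: gen[OF that] gen[OF assms(2)])
  then show ?thesis
    using assms(1) by (auto simp: generator_class_def carrier_integer_mod_group)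
qed

section \<open>The reduced power graph as a comparability graph of divisors\<close>

lemma verts_power_graph:
  "n > 0 \<Longrightarrow> verts (power_graph (integer_mod_group n)) = {0..<int n}"
  by (simp add: power_graph_def carrier_integer_mod_group)

lemma dominates_power_graph:
  assumes "n > 0"
  shows "u \<rightarrow>\<^bsub>power_graph (integer_mod_group n)\<^esub> v \<longleftrightarrow>
           u \<in> {0..<int n} \<and> v \<in> {0..<int n} \<and> u \<noteq> v \<and>
           comparable (cyc_index n u) (cyc_index n v)"
proof -
  have "u \<rightarrow>\<^bsub>power_graph (integer_mod_group n)\<^esub> v \<longleftrightarrow>
          u \<in> {0..<int n} \<and> v \<in> {0..<int n} \<and> u \<noteq> v \<and>
          ((\<exists>k::nat. k > 0 \<and> v = (int k * u) mod int n) \<or>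
           (\<exists>k::nat. k > 0 \<and> u = (int k * v) mod int n))"
    using assms by (auto simp: power_graph_def carrier_integer_mod_group)
  then show ?thesis
    using positive_multiple_iff_cyc_index_dvd[OF assms] by blast
qed

lemma S_set_iff_cyc_index:
  assumes "n > 1" "x \<in> {0..<int n}"
  shows "x \<in> S_set n \<longleftrightarrow> cyc_index n x = 1 \<or> cyc_index n x = n"
proof -
  have zero: "cyc_index n x = n \<longleftrightarrow> x = 0"
  proof
    assume "cyc_index n x = n"
    then have "int n dvd x"
      by (metis gcd_dvd1 int_cyc_index)
    then show "x = 0"
      using assms(2) by (auto dest: zdvd_imp_le)
  qed (simp add: cyc_index_def)
  have unit: "(\<exists>a. x = residue n a \<and> 1 \<le> a \<and> a < n \<and> gcd a n = 1) \<longleftrightarrow> cyc_index n x = 1"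
  proof
    assume "\<exists>a. x = residue n a \<and> 1 \<le> a \<and> a < n \<and> gcd a n = 1"
    then show "cyc_index n x = 1"
      by (auto simp: residue_def cyc_index_def)
  next
    assume idx: "cyc_index n x = 1"
    then have "x \<noteq> 0"
      using assms(1) by (auto simp: cyc_index_def)
    moreover have "gcd (nat x) n = 1"
      using idx assms(2) cyc_index_of_nat[of n "nat x"] by simp
    ultimately show "\<exists>a. x = residue n a \<and> 1 \<le> a \<and> a < n \<and> gcd a n = 1"
      using assms(2) by (intro exI[of _ "nat x"]) (auto simp: residue_def)
  qed
  show ?thesis
    using zero unit by (auto simp: S_set_def residue_def)
qed

lemma verts_reduced_power_graph:
  assumes "n > 1"
  shows "verts (reduced_power_graph n) =
           {x \<in> {0..<int n}. cyc_index n x \<noteq> 1 \<and> cyc_index n x \<noteq> n}"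
  using assms S_set_iff_cyc_index[OF assms]
  by (auto simp: reduced_power_graph_def delete_verts_def verts_power_graph)

lemma dominates_reduced_power_graph:
  assumes "n > 1"
  shows "u \<rightarrow>\<^bsub>reduced_power_graph n\<^esub> v \<longleftrightarrow>
           u \<in> verts (reduced_power_graph n) \<and> v \<in> verts (reduced_power_graph n) \<and> u \<noteq> v \<and>
           comparable (cyc_index n u) (cyc_index n v)"
proof -
  have "verts (reduced_power_graph n) = {0..<int n} - S_set n"
    using assms by (simp add: reduced_power_graph_def delete_verts_def verts_power_graph)
  moreover have "u \<rightarrow>\<^bsub>reduced_power_graph n\<^esub> v \<longleftrightarrow>
      u \<in> {0..<int n} - S_set n \<and> v \<in> {0..<int n} - S_set n \<and> u \<noteq> v \<and>
      comparable (cyc_index n u) (cyc_index n v)"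
    using assms
    by (auto simp: reduced_power_graph_def dominates_delete_verts_iff dominates_power_graph
        verts_power_graph)
  ultimately show ?thesis
    by simp
qed

lemma pseudo_graph_reduced_power_graph:
  assumes "n > 0"
  shows "pseudo_graph (reduced_power_graph n)"
proof -
  have "graph (power_graph (integer_mod_group n))"
    using assms by (intro graph_power_graph) (simp add: carrier_integer_mod_group)
  then show ?thesis
    unfolding reduced_power_graph_def graph_def by (intro pseudo_graph_delete_verts) simp
qed

lemma reduced_neighbourhood_generator_class:
  assumes "n > 1" "d dvd n" "d < n"
  shows "reduced_neighbourhood n (generator_class (integer_mod_group n) (residue n d)) =
           {x \<in> verts (reduced_power_graph n). cyc_index n x \<noteq> d \<and> comparable (cyc_index n x) d}"
proof -
  have n: "n > 0"
    using assms(1) by simp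
  have res: "residue n d = int d" "int d \<in> {0..<int n}"
    using assms by (auto simp: residue_def)
  have cls: "generator_class (integer_mod_group n) (residue n d) =
          {y \<in> {0..<int n}. cyc_index n y = d}"
    using generator_class_integer_mod_group[of n "int d"] assms res
    by (simp add: cyc_index_of_divisor)
  have "int d \<in> {y \<in> {0..<int n}. cyc_index n y = d}"
    using res assms by (simp add: cyc_index_of_divisor)
  then show ?thesis
    unfolding reduced_neighbourhood_def neighbourhood_def cls
    using n S_set_iff_cyc_index[OF assms(1)]
    by (auto simp: verts_power_graph dominates_power_graph verts_reduced_power_graph[OF assms(1)]
        intro!: exI[of _ "int d"])
qed

section \<open>Separating the powers of one prime\<close>

locale prime_power_cofactor =
  fixes n p a m :: nat
  assumes prime_p: "prime p"
    and a_pos: "a \<ge> 1"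
    and n_eq: "n = p ^ a * m"
    and p_ndvd_m: "\<not> p dvd m"
    and m_gt_1: "m > 1"
begin

lemma p_gt_1: "p > 1"
  using prime_p by (rule prime_gt_1_nat)

lemma p_power_gt_1: "b \<ge> 1 \<Longrightarrow> p ^ b > 1"
  using p_gt_1 by (intro one_less_power) auto

lemma m_less_n: "m < n"
  using p_power_gt_1[OF a_pos] m_gt_1 by (simp add: n_eq)

lemma n_gt_1: "n > 1"
  using m_less_n m_gt_1 by simp

sublocale R: pseudo_graph "reduced_power_graph n"
  using n_gt_1 by (intro pseudo_graph_reduced_power_graph) simp

lemma p_power_dvd_n: "b \<le> a \<Longrightarrow> p ^ b dvd n"
  by (simp add: n_eq le_imp_power_dvd)

lemma p_power_less_n:
  assumes "b \<le> a"
  shows "p ^ b < n"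
proof -
  have "p ^ b \<le> p ^ a"
    using assms p_gt_1 by (intro power_increasing) auto
  also have "\<dots> < n"
    using m_gt_1 prime_p by (simp add: n_eq prime_gt_0_nat)
  finally show ?thesis .
qed

lemma divisor_in_verts:
  assumes "d dvd n" "d \<noteq> 1" "d < n"
  shows "int d \<in> verts (reduced_power_graph n)"
  using assms n_gt_1 by (simp add: verts_reduced_power_graph cyc_index_of_divisor)

lemma p_power_in_verts: "1 \<le> b \<Longrightarrow> b \<le> a \<Longrightarrow> int (p ^ b) \<in> verts (reduced_power_graph n)"
  using p_power_gt_1[of b] by (intro divisor_in_verts p_power_dvd_n p_power_less_n) auto

text \<open>The factor \<open>p\<^sup>b\<close> with \<open>b < a\<close> and any divisor of \<open>m\<close> do not exhaust \<open>n\<close>.\<close>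

lemma p_power_mult_divisor_less_n:
  assumes "b < a" "q dvd m"
  shows "p ^ b * q < n"
proof -
  have "p ^ b < p ^ a"
    using assms(1) p_gt_1 by (intro power_strict_increasing) auto
  moreover have "q \<le> m"
    using assms(2) m_gt_1 by (intro dvd_imp_le) auto
  ultimately show ?thesis
    using m_gt_1 mult_le_mono2[of q m "p ^ b"] mult_less_mono1[of "p ^ b" "p ^ a" m]
    unfolding n_eq by linarith
qed

lemma cofactor_divisor:
  assumes "q dvd m"
  shows "q dvd n" "q < n"
proof -
  show "q dvd n"
    using assms by (simp add: n_eq)
  show "q < n"
    using m_less_n m_gt_1 dvd_imp_le[OF assms] by simp
qed

lemma prime_cofactor_incomparable:
  assumes "prime q" "q dvd m"
  shows "\<not> q dvd p ^ b" "1 \<le> b \<Longrightarrow> e dvd m \<Longrightarrow> \<not> p ^ b dvd e"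
proof -
  show "\<not> q dvd p ^ b"
    using assms prime_p p_ndvd_m by (metis prime_dvd_power primes_dvd_imp_eq)
  show "\<not> p ^ b dvd e" if "1 \<le> b" "e dvd m"
    using that p_ndvd_m by (metis dvd_power dvd_trans not_one_le_zero neq0_conv)
qed

lemma divisor_has_prime_cofactor:
  assumes "d dvd n" "\<not> d dvd p ^ a"
  obtains q where "prime q" "q dvd d" "q dvd m"
proof -
  have "\<not> coprime d m"
    using assms by (auto simp: n_eq coprime_dvd_mult_left_iff)
  then obtain q where "prime q" "q dvd gcd d m"
    by (metis coprime_iff_gcd_eq_1 prime_factor_nat)
  then show ?thesis
    using that by auto
qed

text \<open>
  The chain of the vertices of index \<open>p\<^sup>b, \<dots>, p\<^sup>a\<close> has all its further neighbours among
  those of the class of \<open>p\<^sup>b\<close>: a divisor of \<open>n\<close> comparable with some \<open>p\<^sup>c\<close>, \<open>b \<le> c \<le> a\<close>, is a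
  multiple of \<open>p\<^sup>b\<close> or a power of \<open>p\<close>. A prime factor of \<open>m\<close> is cut off by them.
\<close>

lemma not_connected_without_chain_boundary:
  assumes b: "1 \<le> b" "b \<le> a"
  defines "C \<equiv> {x \<in> verts (reduced_power_graph n). p ^ b dvd cyc_index n x \<and> cyc_index n x dvd p ^ a}"
  defines "Y \<equiv> {x \<in> verts (reduced_power_graph n). comparable (cyc_index n x) (p ^ b)} - C"
  shows "\<not> connected (delete_verts (reduced_power_graph n) Y)"
    and "num_components (delete_verts (reduced_power_graph n) Y) > 1"
proof -
  let ?H = "delete_verts (reduced_power_graph n) Y"
  interpret H: pseudo_graph ?H
    by (rule pseudo_graph_delete_verts) (fact R.pseudo_graph_axioms)
  have vertsH: "verts ?H = verts (reduced_power_graph n) - Y"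
    by (simp add: delete_verts_def)
  have u: "int (p ^ b) \<in> C"
    using b p_power_in_verts[OF b] p_power_dvd_n[of b]
    by (simp add: C_def cyc_index_of_divisor le_imp_power_dvd flip: of_nat_power)
  obtain q where q: "prime q" "q dvd m"
    using m_gt_1 prime_factor_nat[of m] by auto
  have idx_q: "cyc_index n (int q) = q"
    using cofactor_divisor[OF q(2)] by (simp add: cyc_index_of_divisor)
  have q_verts: "int q \<in> verts (reduced_power_graph n)"
    using cofactor_divisor[OF q(2)] q(1) by (intro divisor_in_verts) auto
  have q_ninc: "\<not> comparable q (p ^ b)"
    using prime_cofactor_incomparable[OF q, of b] prime_cofactor_incomparable(2)[OF q b(1) q(2)]
    by simp
  have qC: "int q \<notin> C"
    using q_ninc by (simp add: C_def idx_q)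
  have closed: "y \<in> C" if "x \<in> C" "x \<rightarrow>\<^bsub>?H\<^esub> y" for x y
  proof -
    have y: "y \<in> verts (reduced_power_graph n)" "y \<notin> Y"
      and cmp: "comparable (cyc_index n x) (cyc_index n y)"
      using that(2) n_gt_1
      by (auto simp: dominates_delete_verts_iff dominates_reduced_power_graph)
    have x: "p ^ b dvd cyc_index n x" "cyc_index n x dvd p ^ a"
      using that(1) by (auto simp: C_def)
    have "comparable (cyc_index n y) (p ^ b)"
    proof (cases "cyc_index n x dvd cyc_index n y")
      case True
      then show ?thesis
        using x by (meson dvd_trans)
    next
      case False
      then have "cyc_index n y dvd p ^ a"
        using cmp x by (meson dvd_trans)
      then obtain i where "cyc_index n y = p ^ i"
        using prime_p by (auto simp: divides_primepow_nat)
      then show ?thesis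
        by (metis le_imp_power_dvd nat_le_linear)
    qed
    then show ?thesis
      using y by (auto simp: Y_def)
  qed
  have unreachable: "\<not> int (p ^ b) \<rightarrow>\<^sup>*\<^bsub>?H\<^esub> int q"
  proof
    assume "int (p ^ b) \<rightarrow>\<^sup>*\<^bsub>?H\<^esub> int q"
    then have "int q \<in> C"
      by (induction rule: H.reachable_induct) (use u closed in auto)
    then show False
      using qC by simp
  qed
  have verts: "int (p ^ b) \<in> verts ?H" "int q \<in> verts ?H"
    using u q_verts q_ninc unfolding vertsH by (auto simp: C_def Y_def idx_q)
  show "num_components ?H > 1"
    using verts unreachable by (rule H.num_components_gt_1)
  show "\<not> connected ?H"
    using verts unreachable H.symmetric_connected_imp_strongly_connected[OF H.sym_arcs]
    by blast
qed

text \<open>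
  One surviving vertex \<open>x\<close> of the neighbourhood is a hub. It is adjacent to the whole class of
  \<open>p\<^sup>a\<close>, and thereby linked to the other surviving neighbours. If its index is \<open>p\<^sup>j\<close>, \<open>j < a\<close>,
  then it reaches a prime factor \<open>q\<close> of \<open>m\<close> through \<open>p\<^sup>j * q\<close>; otherwise its index is divisible
  by such a \<open>q\<close>.
\<close>

lemma strongly_connected_of_proper_subset:
  defines "X \<equiv> {x \<in> verts (reduced_power_graph n).
                  cyc_index n x \<noteq> p ^ a \<and> comparable (cyc_index n x) (p ^ a)}"
  assumes "Y \<subset> X"
  shows "strongly_connected (delete_verts (reduced_power_graph n) Y)"
proof -
  let ?H = "delete_verts (reduced_power_graph n) Y"
  interpret H: pseudo_graph ?H
    by (rule pseudo_graph_delete_verts) (fact R.pseudo_graph_axioms)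
  have vertsH: "verts ?H = verts (reduced_power_graph n) - Y"
    by (simp add: delete_verts_def)
  obtain x where x: "x \<in> X" "x \<notin> Y"
    using assms(2) by blast
  have xH: "x \<in> verts ?H"
    using x by (auto simp: vertsH X_def)
  have reach: "u \<rightarrow>\<^sup>*\<^bsub>?H\<^esub> v"
    if "u \<in> verts ?H" "v \<in> verts ?H" "comparable (cyc_index n u) (cyc_index n v)" for u v
  proof (cases "u = v")
    case False
    then have "u \<rightarrow>\<^bsub>?H\<^esub> v"
      using that n_gt_1 by (simp add: dominates_delete_verts_iff dominates_reduced_power_graph vertsH)
    then show ?thesis ..
  qed (use that in simp)
  \<comment> \<open>Vertices outside \<open>X\<close> are not deleted.\<close>
  have divisor_verts: "int d \<in> verts ?H" "cyc_index n (int d) = d"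
    if "d dvd n" "d \<noteq> 1" "d < n" "d = p ^ a \<or> \<not> comparable d (p ^ a)" for d
  proof -
    show idx: "cyc_index n (int d) = d"
      using that by (simp add: cyc_index_of_divisor)
    show "int d \<in> verts ?H"
      using divisor_in_verts[of d] that assms(2) idx by (auto simp: vertsH X_def)
  qed
  have "p ^ a \<noteq> 1"
    using p_power_gt_1[OF a_pos] by linarith
  note top = divisor_verts[OF p_power_dvd_n[OF order_refl] this p_power_less_n[OF order_refl]
      disjI1[OF refl]]
  have cofactor_verts: "int e \<in> verts ?H" "cyc_index n (int e) = e"
    if "prime q" "q dvd e" "e dvd m" for q e
  proof -
    have q: "q dvd m"
      using that by (meson dvd_trans)
    have "\<not> e dvd p ^ a"
      using prime_cofactor_incomparable(1)[OF that(1) q] that(2) by (meson dvd_trans)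
    moreover have "\<not> p ^ a dvd e"
      using prime_cofactor_incomparable(2)[OF that(1) q a_pos that(3)] .
    moreover have "e \<noteq> 1"
      using that by auto
    ultimately show "int e \<in> verts ?H" "cyc_index n (int e) = e"
      using divisor_verts[of e] cofactor_divisor[OF that(3)] by auto
  qed
  have primes_linked: "int q \<rightarrow>\<^sup>*\<^bsub>?H\<^esub> int q'"
    if "prime q" "q dvd m" "prime q'" "q' dvd m" for q q'
  proof (cases "q = q'")
    case True
    then show ?thesis
      using cofactor_verts[of q q] that by simp
  next
    case False
    have "q * q' dvd m"
      using that False by (intro divides_mult) (auto simp: primes_coprime)
    then have "int (q * q') \<in> verts ?H" "cyc_index n (int (q * q')) = q * q'"
      using cofactor_verts[of q "q * q'"] that by auto
    then have "int q \<rightarrow>\<^sup>*\<^bsub>?H\<^esub> int (q * q')" "int (q * q') \<rightarrow>\<^sup>*\<^bsub>?H\<^esub> int q'"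
      using cofactor_verts[of q q] cofactor_verts[of q' q'] that by (auto intro!: reach simp del: of_nat_mult)
    then show ?thesis
      by (rule H.reachable_trans)
  qed
  have "\<exists>q. prime q \<and> q dvd m \<and> int q \<rightarrow>\<^sup>*\<^bsub>?H\<^esub> x"
  proof (cases "cyc_index n x dvd p ^ a")
    case True
    then obtain j where j: "j \<le> a" "cyc_index n x = p ^ j"
      using prime_p by (auto simp: divides_primepow_nat)
    then have "j < a"
      using x(1) by (auto simp: X_def le_less)
    obtain q where q: "prime q" "q dvd m"
      using m_gt_1 prime_factor_nat[of m] by auto
    let ?d = "p ^ j * q"
    have "?d dvd n"
      using j(1) q by (simp add: n_eq le_imp_power_dvd mult_dvd_mono)
    moreover have "?d < n"
      using \<open>j < a\<close> q(2) by (rule p_power_mult_divisor_less_n)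
    moreover have "?d \<noteq> 1"
      using q(1) by auto
    moreover have "\<not> ?d dvd p ^ a"
      using prime_cofactor_incomparable(1)[OF q] by (meson dvd_mult_right)
    moreover have "\<not> p ^ a dvd ?d"
    proof
      assume "p ^ a dvd ?d"
      then have "p ^ j * p ^ (a - j) dvd p ^ j * q"
        using j(1) by (simp flip: power_add)
      then have "p ^ (a - j) dvd q"
        using prime_p by (simp add: prime_gt_0_nat)
      then show False
        using prime_cofactor_incomparable(2)[OF q _ q(2), of "a - j"] \<open>j < a\<close> by simp
    qed
    ultimately have d: "int ?d \<in> verts ?H" "cyc_index n (int ?d) = ?d"
      using divisor_verts[of ?d] by blast+
    have "int q \<rightarrow>\<^sup>*\<^bsub>?H\<^esub> int ?d"
      using d cofactor_verts[of q q] q by (intro reach) (auto simp del: of_nat_mult of_nat_power)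
    moreover have "int ?d \<rightarrow>\<^sup>*\<^bsub>?H\<^esub> x"
      using d xH j(2) by (intro reach) (auto simp del: of_nat_mult of_nat_power)
    ultimately show ?thesis
      using q H.reachable_trans by blast
  next
    case False
    then obtain q where q: "prime q" "q dvd cyc_index n x" "q dvd m"
      using divisor_has_prime_cofactor cyc_index_dvd by blast
    then have "int q \<rightarrow>\<^sup>*\<^bsub>?H\<^esub> x"
      using cofactor_verts[of q q] xH by (intro reach) auto
    then show ?thesis
      using q by blast
  qed
  then obtain q where q: "prime q" "q dvd m" "int q \<rightarrow>\<^sup>*\<^bsub>?H\<^esub> x"
    by blast
  show ?thesis
  proof (rule H.strongly_connected_if_all_reach[OF xH])
    fix v assume v: "v \<in> verts ?H"
    show "v \<rightarrow>\<^sup>*\<^bsub>?H\<^esub> x"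
    proof (cases "comparable (cyc_index n v) (p ^ a)")
      case True
      then have "v \<rightarrow>\<^sup>*\<^bsub>?H\<^esub> int (p ^ a)"
        using v top by (intro reach) auto
      also have "int (p ^ a) \<rightarrow>\<^sup>*\<^bsub>?H\<^esub> x"
        using x(1) xH top by (intro reach) (auto simp: X_def)
      finally show ?thesis .
    next
      case False
      then obtain q' where q': "prime q'" "q' dvd cyc_index n v" "q' dvd m"
        using divisor_has_prime_cofactor cyc_index_dvd by blast
      then have "v \<rightarrow>\<^sup>*\<^bsub>?H\<^esub> int q'"
        using v cofactor_verts[of q' q'] by (intro reach) auto
      also have "int q' \<rightarrow>\<^sup>*\<^bsub>?H\<^esub> int q"
        using q' q by (intro primes_linked)
      also note q(3)
      finally show ?thesis .
    qed
  qed
qed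

text \<open>
  If \<open>a > 1\<close>, then \<open>p\<close> is a neighbour of \<open>p\<^sup>a\<close>; if \<open>a = 1\<close>, then \<open>m\<close> is composite and \<open>p * q\<close> is
  a neighbour for any prime factor \<open>q\<close> of \<open>m\<close>.
\<close>

lemma neighbourhood_of_full_power_nonempty:
  assumes "\<not> (\<exists>q s. prime q \<and> prime s \<and> n = q * s)"
  shows "{x \<in> verts (reduced_power_graph n).
            cyc_index n x \<noteq> p ^ a \<and> comparable (cyc_index n x) (p ^ a)} \<noteq> {}"
proof (cases "a = 1")
  case False
  then have "p \<noteq> p ^ a" "p dvd p ^ a"
    using a_pos p_gt_1 power_inject_exp[of p 1 a] by auto
  moreover have "int p \<in> verts (reduced_power_graph n)" "cyc_index n (int p) = p"
    using p_power_in_verts[of 1] p_power_dvd_n[of 1] a_pos by (auto simp: cyc_index_of_divisor)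
  ultimately show ?thesis
    by auto
next
  case True
  obtain q where q: "prime q" "q dvd m"
    using m_gt_1 prime_factor_nat[of m] by auto
  have dvd: "p * q dvd n"
    using q True by (simp add: n_eq)
  moreover have "p * q \<noteq> n"
    using assms prime_p q by auto
  ultimately have "p * q < n"
    using n_gt_1 by (meson dvd_imp_le le_neq_implies_less less_trans zero_less_one)
  moreover have "p * q \<noteq> 1" "p * q \<noteq> p"
    using q prime_p by auto
  ultimately show ?thesis
    using divisor_in_verts[of "p * q"] dvd True
    by (auto simp: cyc_index_of_divisor intro!: exI[of _ "int (p * q)"] simp del: of_nat_mult)
qed

theorem minimal_separating_set_full_power:
  assumes "\<not> (\<exists>q s. prime q \<and> prime s \<and> n = q * s)"
  shows "minimal_separating_set (reduced_power_graph n)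
           (reduced_neighbourhood n (generator_class (integer_mod_group n) (residue n (p ^ a))))"
proof -
  let ?R = "reduced_power_graph n"
  define X where "X = {x \<in> verts ?R. cyc_index n x \<noteq> p ^ a \<and> comparable (cyc_index n x) (p ^ a)}"
  have X: "reduced_neighbourhood n (generator_class (integer_mod_group n) (residue n (p ^ a))) = X"
    using reduced_neighbourhood_generator_class[OF n_gt_1 p_power_dvd_n p_power_less_n, of a]
    by (simp add: X_def)
  \<comment> \<open>For \<open>b = a\<close> the chain is just the class of \<open>p\<^sup>a\<close>.\<close>
  have "X = {x \<in> verts ?R. comparable (cyc_index n x) (p ^ a)} -
              {x \<in> verts ?R. p ^ a dvd cyc_index n x \<and> cyc_index n x dvd p ^ a}"
    by (auto simp: X_def intro: dvd_antisym)
  then have "num_components (delete_verts ?R X) > 1"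
    using not_connected_without_chain_boundary(2)[OF a_pos order_refl] by simp
  moreover have "{} \<subset> X"
    using neighbourhood_of_full_power_nonempty[OF assms] by (auto simp: X_def)
  then have "strongly_connected ?R"
    using strongly_connected_of_proper_subset[of "{}"] delete_verts_empty[OF R.wf_digraph_axioms]
    by (simp add: X_def)
  then have "num_components ?R = 1"
    by (rule R.num_components_strongly_connected)
  ultimately have "separating_set ?R X"
    by (auto simp: separating_set_def X_def)
  moreover have "connected (delete_verts ?R Y)" if "Y \<subset> X" for Y
  proof -
    interpret H: pseudo_graph "delete_verts ?R Y"
      by (rule pseudo_graph_delete_verts) (fact R.pseudo_graph_axioms)
    have "strongly_connected (delete_verts ?R Y)"
      using strongly_connected_of_proper_subset[of Y] that by (simp add: X_def)
    then show ?thesis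
      unfolding connected_def strongly_connected_def
      by (simp add: H.reachable_mk_symmetric_eq[OF H.sym_arcs])
  qed
  ultimately show ?thesis
    by (simp add: X minimal_separating_set_def)
qed

theorem not_minimal_separating_set_smaller_power:
  assumes "1 \<le> b" "b < a"
  shows "\<not> minimal_separating_set (reduced_power_graph n)
           (reduced_neighbourhood n (generator_class (integer_mod_group n) (residue n (p ^ b))))"
proof -
  let ?R = "reduced_power_graph n"
  define X where "X = {x \<in> verts ?R. cyc_index n x \<noteq> p ^ b \<and> comparable (cyc_index n x) (p ^ b)}"
  define C where "C = {x \<in> verts ?R. p ^ b dvd cyc_index n x \<and> cyc_index n x dvd p ^ a}"
  define Y where "Y = {x \<in> verts ?R. comparable (cyc_index n x) (p ^ b)} - C"
  have X: "reduced_neighbourhood n (generator_class (integer_mod_group n) (residue n (p ^ b))) = X"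
    using reduced_neighbourhood_generator_class[OF n_gt_1 p_power_dvd_n p_power_less_n, of b] assms
    by (simp add: X_def)
  have "\<not> connected (delete_verts ?R Y)"
    using not_connected_without_chain_boundary(1)[of b] assms by (simp add: Y_def C_def)
  moreover have "Y \<subset> X"
  proof
    show "Y \<subseteq> X"
      using assms by (auto simp: X_def Y_def C_def le_imp_power_dvd)
    \<comment> \<open>The end \<open>p\<^sup>a\<close> of the chain lies in \<open>X\<close> because \<open>b < a\<close>.\<close>
    have "int (p ^ a) \<in> verts ?R" "cyc_index n (int (p ^ a)) = p ^ a"
      using p_power_in_verts[OF a_pos order_refl]
      by (simp_all only: cyc_index_of_divisor[OF p_power_dvd_n[OF order_refl]])
    moreover have "p ^ a \<noteq> p ^ b"
      using assms(2) power_inject_exp[of p a b] p_gt_1 by simp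
    ultimately have "int (p ^ a) \<in> X - Y"
      using assms by (simp add: X_def Y_def C_def le_imp_power_dvd del: of_nat_power)
    then show "Y \<noteq> X"
      by blast
  qed
  moreover have "Y \<noteq> {}"
  proof -
    \<comment> \<open>\<open>p\<^sup>b * q\<close> is a neighbour of \<open>p\<^sup>b\<close> outside the chain.\<close>
    obtain q where q: "prime q" "q dvd m"
      using m_gt_1 prime_factor_nat[of m] by auto
    let ?d = "p ^ b * q"
    have d: "?d dvd n" "?d < n" "?d \<noteq> 1" "\<not> ?d dvd p ^ a"
      using assms q p_power_mult_divisor_less_n[OF assms(2) q(2)] prime_cofactor_incomparable(1)[OF q]
      by (auto simp: n_eq le_imp_power_dvd mult_dvd_mono dest: dvd_mult_right)
    then have "int ?d \<in> Y"
      using divisor_in_verts[of ?d]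
      by (simp add: Y_def C_def cyc_index_of_divisor del: of_nat_mult of_nat_power)
    then show ?thesis
      by blast
  qed
  ultimately show ?thesis
    by (metis X minimal_separating_set_def)
qed

end

section \<open>The prime powers in a factorization\<close>

theorem theorem2p22:
  fixes n r k :: nat and p \<alpha> :: "nat \<Rightarrow> nat"
  assumes "\<not> (\<exists>q s. prime q \<and> prime s \<and> n = q * s)"
    and "r \<ge> 2"
    and "\<forall>i\<in>{1..r}. prime (p i)"
    and "strict_mono_on {1..r} p"
    and "\<forall>i\<in>{1..r}. \<alpha> i \<ge> 1"
    and "n = (\<Prod>i=1..r. p i ^ \<alpha> i)"
    and "k \<in> {1..r}"
  shows "minimal_separating_set (reduced_power_graph n)
           (reduced_neighbourhood n
              (generator_class (integer_mod_group n) (residue n (p k ^ \<alpha> k))))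
       \<and> (\<forall>\<beta>::nat. \<alpha> k > 1 \<and> 1 \<le> \<beta> \<and> \<beta> < \<alpha> k \<longrightarrow>
           \<not> minimal_separating_set (reduced_power_graph n)
               (reduced_neighbourhood n
                  (generator_class (integer_mod_group n) (residue n (p k ^ \<beta>)))))"
proof -
  define m where "m = (\<Prod>i\<in>{1..r} - {k}. p i ^ \<alpha> i)"
  have n_eq: "n = p k ^ \<alpha> k * m"
    using assms(6,7) by (simp add: m_def prod.remove)
  have "\<not> p k dvd m"
  proof
    assume "p k dvd m"
    then have "\<exists>i\<in>{1..r} - {k}. p k dvd p i ^ \<alpha> i"
      using assms(3,7) by (simp add: m_def prime_dvd_prod_iff)
    then obtain i where i: "i \<in> {1..r} - {k}" "p k dvd p i ^ \<alpha> i" ..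
    then have "p k = p i"
      using assms(3,7) by (meson DiffD1 prime_dvd_power primes_dvd_imp_eq)
    then show False
      using strict_mono_on_imp_inj_on[OF assms(4)] i(1) assms(7) by (auto dest: inj_onD)
  qed
  moreover have "m > 1"
  proof -
    \<comment> \<open>Since \<open>r \<ge> 2\<close>, there is a second prime.\<close>
    define i :: nat where "i = (if k = 1 then 2 else 1)"
    have i: "i \<in> {1..r} - {k}"
      using assms(2,7) by (auto simp: i_def)
    then have "\<alpha> i \<noteq> 0"
      using assms(5) by fastforce
    then have "p i dvd p i ^ \<alpha> i"
      by (intro dvd_power) simp
    also have "\<dots> dvd m"
      unfolding m_def using i by (intro dvd_prodI) auto
    finally have "p i dvd m" .
    moreover have "m > 0"
      unfolding m_def using assms(3) by (intro prod_pos) (simp add: prime_gt_0_nat)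
    ultimately have "p i \<le> m"
      by (intro dvd_imp_le)
    moreover have "p i > 1"
      using assms(3) i by (blast intro: prime_gt_1_nat)
    ultimately show ?thesis
      by simp
  qed
  moreover have "prime (p k)" "\<alpha> k \<ge> 1"
    using assms(3,5,7) by blast+
  ultimately interpret prime_power_cofactor n "p k" "\<alpha> k" m
    using n_eq by unfold_locales
  show ?thesis
    using minimal_separating_set_full_power[OF assms(1)]
    by (simp add: not_minimal_separating_set_smaller_power)
qed

end
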